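(* Let $d\ge 2$ be an even integer, $M\ge 1$ and $p\ge 0$ integers, $N=2M+1$, and let $\gamma\ge 0$ be an integrable weighting function on $[0,\pi]$. Assume that the KKT matrix of the optimization problem $(\mathcal P)$ described in the context is invertible, and let $(\mathbf a_d^*,\mathbf b_d^* )\in\mathbb R^N\times\mathbb R^N$ be the (unique) optimal solution of $(\mathcal P)$. Then both $\mathbf a_d^*$ and $\mathbf b_d^*$ are symmetric about the central element, i.e. $\mathbf J\mathbf a_d^*=\mathbf a_d^*$ and $\mathbf J\mathbf b_d^*=\mathbf b_d^*$, where $\mathbf J$ is the $N\times N$ anti-diagonal identity matrix (the matrix reversing the order of the entries of a vector).
   Context: Vectors in $\mathbb R^N$, $N=2M+1$, are indexed by $m\in\{-M,\dots,M\}$: $\mathbf a_d=(\mathrm a_{-M},\dots,\mathrm a_M)^T$, $\mathbf b_d=(\mathrm b_{-M},\dots,\mathrm b_M)^T$. These are the coefficients of a compact finite difference scheme $\sum_{m=-M}^M \mathrm b_m f^{(d)}_{i+m}=\frac1{(\Delta x)^d}\sum_{m=-M}^M\mathrm a_m f_{i+m}$ approximating the $d$-th derivative. For $\eta\in[0,\pi]$ put $\mathbf C(\eta)=(\cos(m\eta))_{m=-M}^{M}$ and $\mathbf S(\eta)=(\sin(m\eta))_{m=-M}^{M}$ (column vectors). For even $d=2q$ let $$\mathcal E(\mathbf a_d,\mathbf b_d)=\int_0^\pi \gamma(\eta)\Big[\big(\mathbf C^T(\eta)\mathbf a_d-(-1)^q\eta^d\,\mathbf C^T(\eta)\mathbf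 b_d\big)^2+\big(\mathbf S^T(\eta)\mathbf a_d-(-1)^q\eta^d\,\mathbf S^T(\eta)\mathbf b_d\big)^2\Big]d\eta=\begin{pmatrix}\mathbf a_d\\ \mathbf b_d\end{pmatrix}^T\mathbf Q_d\begin{pmatrix}\mathbf a_d\\ \mathbf b_d\end{pmatrix},$$ where $\mathbf Q_d$ is the symmetric $2N\times 2N$ matrix of this quadratic form. Problem $(\mathcal P)$: minimize $\mathcal E(\mathbf a_d,\mathbf b_d)$ over $\mathbf a_d,\mathbf b_d\in\mathbb R^N$ subject to the linear constraints (with the convention $0^0=1$) - $\sum_{m=-M}^M \mathrm a_m m^k=0$ for $k=0,\dots,d-1$; - $\sum_{m=-M}^M\left(\frac{m^{d+r}}{(d+r)!}\mathrm a_m-\frac{m^r}{r!}\mathrm b_m\right)=0$ for $r=0,\dots,p$; - $\mathrm b_0=1$. Let $\mathbf K$ be the $(d+p+2)\times 2N$ matrix whose rows are the coefficient vectors of these $d+p+2$ linear constraints acting on $(\mathbf a_d^T,\mathbf b_d^T)^T$. The KKT matrix of $(\mathcal P)$ is $\begin{bmatrix}\mathbf Q_d&\mathbf K^T\\ \mathbf K&\mathbf 0\end{bmatrix}$. *)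

theory Defs
  imports "HOL-Analysis.Analysis" "Jordan_Normal_Form.Matrix"
begin

unbundle no vec_syntax and no inner_syntax

text \<open>
  Vectors of \<open>\<real>\<^sup>N\<close>, \<open>N = 2 * M + 1\<close>, are elements of \<open>carrier_vec (2 * M + 1)\<close>. Position \<open>i\<close>
  (counted from \<open>0\<close>) carries the coefficient with index \<open>m = i - M \<in> {-M, \<dots>, M}\<close>.
\<close>

definition grid :: "nat \<Rightarrow> nat \<Rightarrow> real" where
  "grid M i = real i - real M"

definition cos_vec :: "nat \<Rightarrow> real \<Rightarrow> real vec" where
  "cos_vec M \<eta> = Matrix.vec (2 * M + 1) (\<lambda>i. cos (grid M i * \<eta>))"

definition sin_vec :: "nat \<Rightarrow> real \<Rightarrow> real vec" where
  "sin_vec M \<eta> = Matrix.vec (2 * M + 1) (\<lambda>i. sin (grid M i * \<eta>))"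

text \<open>The spectral error functional for a derivative of even order \<open>d = 2 * q\<close>.\<close>

definition spectral_error :: "nat \<Rightarrow> nat \<Rightarrow> (real \<Rightarrow> real) \<Rightarrow> real vec \<Rightarrow> real vec \<Rightarrow> real" where
  "spectral_error M d \<gamma> a b = (LINT \<eta>:{0..pi}|lebesgue. \<gamma> \<eta> *
     ((cos_vec M \<eta> \<bullet> a - (-1) ^ (d div 2) * \<eta> ^ d * (cos_vec M \<eta> \<bullet> b))\<^sup>2 +
      (sin_vec M \<eta> \<bullet> a - (-1) ^ (d div 2) * \<eta> ^ d * (sin_vec M \<eta> \<bullet> b))\<^sup>2))"

definition is_error_matrix :: "nat \<Rightarrow> nat \<Rightarrow> (real \<Rightarrow> real) \<Rightarrow> real mat \<Rightarrow> bool" where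
  "is_error_matrix M d \<gamma> Q \<longleftrightarrow>
     Q \<in> carrier_mat (2 * (2 * M + 1)) (2 * (2 * M + 1)) \<and> transpose_mat Q = Q \<and>
     (\<forall>a \<in> carrier_vec (2 * M + 1). \<forall>b \<in> carrier_vec (2 * M + 1).
        spectral_error M d \<gamma> a b = (a @\<^sub>v b) \<bullet> (Q *\<^sub>v (a @\<^sub>v b)))"

text \<open>
  The symmetric matrix of the quadratic form. It exists and is unique for every integrable
  weight; see \<open>ex1_error_matrix\<close> below.
\<close>

definition error_matrix :: "nat \<Rightarrow> nat \<Rightarrow> (real \<Rightarrow> real) \<Rightarrow> real mat" where
  "error_matrix M d \<gamma> = (THE Q. is_error_matrix M d \<gamma> Q)"

definition feasible :: "nat \<Rightarrow> nat \<Rightarrow> nat \<Rightarrow> real vec \<Rightarrow> real vec \<Rightarrow> bool" where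
  "feasible M d p a b \<longleftrightarrow>
     a \<in> carrier_vec (2 * M + 1) \<and> b \<in> carrier_vec (2 * M + 1) \<and>
     (\<forall>k<d. (\<Sum>i<2 * M + 1. a $ i * grid M i ^ k) = 0) \<and>
     (\<forall>r\<le>p. (\<Sum>i<2 * M + 1. grid M i ^ (d + r) / fact (d + r) * a $ i
                              - grid M i ^ r / fact r * b $ i) = 0) \<and>
     b $ M = 1"

definition optimal :: "nat \<Rightarrow> nat \<Rightarrow> nat \<Rightarrow> (real \<Rightarrow> real) \<Rightarrow> real vec \<Rightarrow> real vec \<Rightarrow> bool" where
  "optimal M d p \<gamma> a b \<longleftrightarrow>
     is_arg_min (\<lambda>(a, b). spectral_error M d \<gamma> a b) (\<lambda>(a, b). feasible M d p a b) (a, b)"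

text \<open>
  Rows \<open>0, \<dots>, d - 1\<close> are the moment conditions on \<open>a\<close>, rows \<open>d, \<dots>, d + p\<close> the order conditions
  and row \<open>d + p + 1\<close> the normalization \<open>b\<^sub>0 = 1\<close>. Columns \<open>0, \<dots>, 2 * M\<close> act on \<open>a\<close>, columns
  \<open>2 * M + 1, \<dots>, 4 * M + 1\<close> on \<open>b\<close>.
\<close>

definition constraint_matrix :: "nat \<Rightarrow> nat \<Rightarrow> nat \<Rightarrow> real mat" where
  "constraint_matrix M d p = Matrix.mat (d + p + 2) (2 * (2 * M + 1)) (\<lambda>(k, j).
     let N = 2 * M + 1 in
     if k < d then (if j < N then grid M j ^ k else 0)
     else if k \<le> d + p then
       (if j < N then grid M j ^ k / fact k
        else - (grid M (j - N) ^ (k - d) / fact (k - d)))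
     else (if j = N + M then 1 else 0))"

definition KKT_matrix :: "nat \<Rightarrow> nat \<Rightarrow> nat \<Rightarrow> (real \<Rightarrow> real) \<Rightarrow> real mat" where
  "KKT_matrix M d p \<gamma> =
     four_block_mat (error_matrix M d \<gamma>) (transpose_mat (constraint_matrix M d p))
       (constraint_matrix M d p) (0\<^sub>m (d + p + 2) (d + p + 2))"

definition exchange_matrix :: "nat \<Rightarrow> real mat" where
  "exchange_matrix n = Matrix.mat n n (\<lambda>(i, j). if i + j + 1 = n then 1 else 0)"


lemma scalar_prod_append_split:
  fixes f g :: "nat \<Rightarrow> real"
  assumes "a \<in> carrier_vec n" "b \<in> carrier_vec n"
  shows "(\<Sum>j<2 * n. (if j < n then f j else g (j - n)) * (a @\<^sub>v b) $ j) =
           (\<Sum>j<n. f j * a $ j) + (\<Sum>j<n. g j * b $ j)"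
proof -
  let ?h = "\<lambda>j. (if j < n then f j else g (j - n)) * (a @\<^sub>v b) $ j"
  have "(\<Sum>j<2 * n. ?h j) = (\<Sum>j<n. ?h j) + (\<Sum>j<n. ?h (n + j))"
  proof -
    have "(\<Sum>j<n + n. ?h j) = (\<Sum>j<n. ?h j) + (\<Sum>j\<in>{n..<n+n}. ?h j)"
      using sum.atLeastLessThan_concat[of 0 n "n + n" ?h] by (simp only: atLeast0LessThan le0 le_add1)
    also have "(\<Sum>j\<in>{n..<n+n}. ?h j) = (\<Sum>j<n. ?h (n + j))"
      using sum.shift_bounds_nat_ivl[of ?h 0 n n]
      by (simp only: atLeast0LessThan add.commute add_0)
    finally show ?thesis by (simp only: mult_2)
  qed
  moreover have "(\<Sum>j<n. ?h j) = (\<Sum>j<n. f j * a $ j)"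
    using assms by (intro sum.cong) auto
  moreover have "(\<Sum>j<n. ?h (n + j)) = (\<Sum>j<n. g j * b $ j)"
    using assms by (intro sum.cong) auto
  ultimately show ?thesis by simp
qed

lemma feasible_iff_constraint_matrix:
  assumes a: "a \<in> carrier_vec (2 * M + 1)" and b: "b \<in> carrier_vec (2 * M + 1)"
  shows "feasible M d p a b \<longleftrightarrow>
           constraint_matrix M d p *\<^sub>v (a @\<^sub>v b) = unit_vec (d + p + 2) (d + p + 1)"
proof -
  let ?N = "2 * M + 1"
  let ?K = "constraint_matrix M d p"
  have Kc: "?K \<in> carrier_mat (d + p + 2) (2 * ?N)"
    by (simp add: constraint_matrix_def)
  have K1: "?K $$ (k, j) = (if j < ?N then grid M j ^ k else (\<lambda>_. 0) (j - ?N))"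
    if "k < d" "j < 2 * ?N" for k j
    using that by (simp add: constraint_matrix_def Let_def)
  have K2: "?K $$ (d + r, j) = (if j < ?N then grid M j ^ (d + r) / fact (d + r)
      else (\<lambda>i. - (grid M i ^ r / fact r)) (j - ?N))" if "r \<le> p" "j < 2 * ?N" for r j
    using that by (simp add: constraint_matrix_def Let_def)
  have K3: "?K $$ (d + p + 1, j) =
      (if j < ?N then (\<lambda>_. 0) j else (\<lambda>i. if i = M then 1 else 0) (j - ?N))"
    if "j < 2 * ?N" for j
    using that by (auto simp: constraint_matrix_def Let_def)
  have row: "(?K *\<^sub>v (a @\<^sub>v b)) $ k = (\<Sum>j<2 * ?N. ?K $$ (k, j) * (a @\<^sub>v b) $ j)"
    if "k < d + p + 2" for k
  proof -
    have "(?K *\<^sub>v (a @\<^sub>v b)) $ k = (\<Sum>j\<in>{0..<?N + ?N}. row ?K k $ j * (a @\<^sub>v b) $ j)"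
      using that a b carrier_matD[OF Kc] by (simp add: scalar_prod_def)
    also have "\<dots> = (\<Sum>j\<in>{0..<?N + ?N}. ?K $$ (k, j) * (a @\<^sub>v b) $ j)"
      using that carrier_matD[OF Kc] by (intro sum.cong refl) simp
    finally show ?thesis by (simp only: atLeast0LessThan mult_2)
  qed
  have r1: "(?K *\<^sub>v (a @\<^sub>v b)) $ k = (\<Sum>i<?N. a $ i * grid M i ^ k)" if "k < d" for k
  proof -
    have "(?K *\<^sub>v (a @\<^sub>v b)) $ k =
        (\<Sum>j<2 * ?N. (if j < ?N then grid M j ^ k else (\<lambda>_. 0) (j - ?N)) * (a @\<^sub>v b) $ j)"
      unfolding row[OF trans_less_add1[OF trans_less_add1[OF that]]]
      by (intro sum.cong refl) (simp only: K1[OF that] lessThan_iff)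
    also have "\<dots> = (\<Sum>j<?N. grid M j ^ k * a $ j) + (\<Sum>j<?N. 0 * b $ j)"
      by (rule scalar_prod_append_split[OF a b])
    finally show ?thesis
      by (simp only: mult_zero_left sum.neutral_const add_0_right mult.commute)
  qed
  have r2: "(?K *\<^sub>v (a @\<^sub>v b)) $ (d + r) =
      (\<Sum>i<?N. grid M i ^ (d + r) / fact (d + r) * a $ i - grid M i ^ r / fact r * b $ i)"
    if "r \<le> p" for r
  proof -
    have "(?K *\<^sub>v (a @\<^sub>v b)) $ (d + r) =
        (\<Sum>j<2 * ?N. (if j < ?N then grid M j ^ (d + r) / fact (d + r)
           else (\<lambda>i. - (grid M i ^ r / fact r)) (j - ?N)) * (a @\<^sub>v b) $ j)"
    proof -
      have k: "d + r < d + p + 2" using that by simp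
      show ?thesis
        unfolding row[OF k] by (intro sum.cong refl) (simp only: K2[OF that] lessThan_iff)
    qed
    also have "\<dots> = (\<Sum>j<?N. grid M j ^ (d + r) / fact (d + r) * a $ j) +
        (\<Sum>j<?N. - (grid M j ^ r / fact r) * b $ j)"
      by (rule scalar_prod_append_split[OF a b])
    finally show ?thesis
      by (simp only: mult_minus_left sum_negf sum_subtractf add_uminus_conv_diff)
  qed
  have r3: "(?K *\<^sub>v (a @\<^sub>v b)) $ (d + p + 1) = b $ M"
  proof -
    have "(?K *\<^sub>v (a @\<^sub>v b)) $ (d + p + 1) =
        (\<Sum>j<2 * ?N. (if j < ?N then (\<lambda>_. 0) j
           else (\<lambda>i. if i = M then 1 else 0) (j - ?N)) * (a @\<^sub>v b) $ j)"
    proof -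
      have k: "d + p + 1 < d + p + 2" by simp
      show ?thesis
        unfolding row[OF k] by (intro sum.cong refl) (simp only: K3 lessThan_iff)
    qed
    also have "\<dots> = (\<Sum>j<?N. 0 * a $ j) + (\<Sum>j<?N. (if j = M then 1 else 0) * b $ j)"
      by (rule scalar_prod_append_split[OF a b])
    also have "\<dots> = (\<Sum>j<?N. (if j = M then 1 else 0) * b $ j)"
      by simp
    also have "\<dots> = (\<Sum>j<?N. if j = M then b $ j else 0)"
      by (intro sum.cong refl) simp
    finally show ?thesis by simp
  qed
  have "?K *\<^sub>v (a @\<^sub>v b) = unit_vec (d + p + 2) (d + p + 1) \<longleftrightarrow>
      (\<forall>k < d + p + 2. (?K *\<^sub>v (a @\<^sub>v b)) $ k = (if k = d + p + 1 then 1 else 0))"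
    using carrier_matD[OF Kc] by (simp add: vec_eq_iff)
  also have "\<dots> \<longleftrightarrow> (\<forall>k<d. (?K *\<^sub>v (a @\<^sub>v b)) $ k = 0) \<and>
      (\<forall>r\<le>p. (?K *\<^sub>v (a @\<^sub>v b)) $ (d + r) = 0) \<and> (?K *\<^sub>v (a @\<^sub>v b)) $ (d + p + 1) = 1"
    (is "?L \<longleftrightarrow> ?R")
  proof
    assume ?L then show ?R by auto
  next
    assume R: ?R
    show ?L
    proof (intro allI impI)
      fix k assume k: "k < d + p + 2"
      consider "k < d" | r where "r \<le> p" "k = d + r" | "k = d + p + 1"
      proof (cases "d \<le> k \<and> k \<le> d + p")
        case True
        then show thesis using that(2)[of "k - d"] by auto
      qed (use that k in linarith)
      then show "(?K *\<^sub>v (a @\<^sub>v b)) $ k = (if k = d + p + 1 then 1 else 0)"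
        using R by cases auto
    qed
  qed
  finally show ?thesis
    using a b r1 r2 r3 by (simp add: feasible_def)
qed

lemma ex1_error_matrix:
  assumes \<gamma>: "set_integrable lebesgue {0..pi} \<gamma>"
  shows "\<exists>!Q. is_error_matrix M d \<gamma> Q"
proof -
  define N where "N = 2 * M + 1"
  define s where "s = (\<lambda>\<eta>::real. (-1) ^ (d div 2) * \<eta> ^ d)"
  define u where "u = (\<lambda>\<eta> j. if j < N then cos (grid M j * \<eta>)
      else - s \<eta> * cos (grid M (j - N) * \<eta>))"
  define v where "v = (\<lambda>\<eta> j. if j < N then sin (grid M j * \<eta>)
      else - s \<eta> * sin (grid M (j - N) * \<eta>))"
  define w where "w = (\<lambda>\<eta> i j. u \<eta> i * u \<eta> j + v \<eta> i * v \<eta> j)"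
  define Q where "Q = Matrix.mat (2 * N) (2 * N) (\<lambda>(i, j). LINT \<eta>:{0..pi}|lebesgue. \<gamma> \<eta> * w \<eta> i j)"
  have w_sym: "w \<eta> i j = w \<eta> j i" for \<eta> i j
    by (simp add: w_def mult.commute)
  have cont: "continuous_on {0..pi} (\<lambda>\<eta>. w \<eta> i j)" for i j
    unfolding w_def u_def v_def s_def
    by (cases "i < N"; cases "j < N") (auto intro!: continuous_intros)
  have int: "set_integrable lebesgue {0..pi} (\<lambda>\<eta>. \<gamma> \<eta> * w \<eta> i j)" for i j
  proof -
    have "set_integrable lebesgue {0..pi} (\<lambda>\<eta>. w \<eta> i j * \<gamma> \<eta>)"
    proof (rule absolutely_integrable_bounded_measurable_product_real)
      show "(\<lambda>\<eta>. w \<eta> i j) \<in> borel_measurable (lebesgue_on {0..pi})"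
        by (intro continuous_imp_measurable_on_sets_lebesgue cont) auto
      show "bounded ((\<lambda>\<eta>. w \<eta> i j) ` {0..pi})"
        by (intro compact_imp_bounded compact_continuous_image cont) auto
    qed (use \<gamma> in auto)
    then show ?thesis by (simp add: mult.commute)
  qed
  have form: "spectral_error M d \<gamma> a b = (a @\<^sub>v b) \<bullet> (Q *\<^sub>v (a @\<^sub>v b))"
    if a: "a \<in> carrier_vec N" and b: "b \<in> carrier_vec N" for a b
  proof -
    let ?x = "a @\<^sub>v b"
    have cs: "cos_vec M \<eta> = Matrix.vec N (\<lambda>i. cos (grid M i * \<eta>))"
      "sin_vec M \<eta> = Matrix.vec N (\<lambda>i. sin (grid M i * \<eta>))" for \<eta>
      by (simp_all add: cos_vec_def sin_vec_def N_def)
    have U: "cos_vec M \<eta> \<bullet> a - (-1) ^ (d div 2) * \<eta> ^ d * (cos_vec M \<eta> \<bullet> b) =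
        (\<Sum>j<2*N. u \<eta> j * ?x $ j)" for \<eta>
      unfolding u_def
      by (subst scalar_prod_append_split[OF a b])
        (use a b in \<open>auto simp: cs scalar_prod_def s_def atLeast0LessThan
           sum_distrib_left sum_negf mult.assoc\<close>)
    have V: "sin_vec M \<eta> \<bullet> a - (-1) ^ (d div 2) * \<eta> ^ d * (sin_vec M \<eta> \<bullet> b) =
        (\<Sum>j<2*N. v \<eta> j * ?x $ j)" for \<eta>
      unfolding v_def
      by (subst scalar_prod_append_split[OF a b])
        (use a b in \<open>auto simp: cs scalar_prod_def s_def atLeast0LessThan
           sum_distrib_left sum_negf mult.assoc\<close>)
    have "\<gamma> \<eta> * ((\<Sum>j<2*N. u \<eta> j * ?x $ j)\<^sup>2 + (\<Sum>j<2*N. v \<eta> j * ?x $ j)\<^sup>2) =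
        (\<Sum>i<2*N. \<Sum>j<2*N. (\<gamma> \<eta> * w \<eta> i j) * (?x $ i * ?x $ j))" for \<eta>
    proof -
      have "(\<Sum>i<2*N. \<Sum>j<2*N. (\<gamma> \<eta> * w \<eta> i j) * (?x $ i * ?x $ j)) =
          (\<Sum>i<2*N. \<Sum>j<2*N. \<gamma> \<eta> * ((u \<eta> i * ?x $ i) * (u \<eta> j * ?x $ j)) +
             \<gamma> \<eta> * ((v \<eta> i * ?x $ i) * (v \<eta> j * ?x $ j)))"
        by (intro sum.cong refl) (simp add: w_def distrib_left distrib_right mult_ac)
      also have "\<dots> = \<gamma> \<eta> * (\<Sum>i<2*N. \<Sum>j<2*N. (u \<eta> i * ?x $ i) * (u \<eta> j * ?x $ j)) +
          \<gamma> \<eta> * (\<Sum>i<2*N. \<Sum>j<2*N. (v \<eta> i * ?x $ i) * (v \<eta> j * ?x $ j))"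
        by (simp only: sum.distrib sum_distrib_left)
      finally show ?thesis
        by (simp only: power2_eq_square sum_product distrib_left)
    qed
    then have "spectral_error M d \<gamma> a b = (LINT \<eta>:{0..pi}|lebesgue.
        (\<Sum>i<2*N. \<Sum>j<2*N. (\<gamma> \<eta> * w \<eta> i j) * (?x $ i * ?x $ j)))"
      by (simp add: spectral_error_def U V)
    also have "\<dots> = (\<Sum>i<2*N. \<Sum>j<2*N. (LINT \<eta>:{0..pi}|lebesgue.
        (\<gamma> \<eta> * w \<eta> i j) * (?x $ i * ?x $ j)))"
    proof -
      have I: "integrable lebesgue
          (\<lambda>\<eta>. indicat_real {0..pi} \<eta> *\<^sub>R ((\<gamma> \<eta> * w \<eta> i j) * (?x $ i * ?x $ j)))" for i j
        using set_integrable_mult_left[of "?x $ i * ?x $ j" lebesgue "{0..pi}", OF int]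
        unfolding set_integrable_def .
      show ?thesis
        unfolding set_lebesgue_integral_def scaleR_sum_right
        by (simp only: Bochner_Integration.integral_sum Bochner_Integration.integrable_sum I)
    qed
    also have "\<dots> = (\<Sum>i<2*N. \<Sum>j<2*N. Q $$ (i, j) * (?x $ i * ?x $ j))"
      by (intro sum.cong refl) (simp add: Q_def)
    also have "\<dots> = ?x \<bullet> (Q *\<^sub>v ?x)"
    proof -
      have "?x \<bullet> (Q *\<^sub>v ?x) = (\<Sum>i<2*N. ?x $ i * (\<Sum>j<2*N. Q $$ (i, j) * ?x $ j))"
        using a b by (auto simp: scalar_prod_def Q_def atLeast0LessThan mult_2 intro!: sum.cong)
      then show ?thesis
        by (simp add: sum_distrib_left mult_ac)
    qed
    finally show ?thesis .
  qed
  show ?thesis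
  proof (rule ex1I)
    have "transpose_mat Q = Q"
      by (rule eq_matI) (simp_all add: Q_def w_sym)
    then show "is_error_matrix M d \<gamma> Q"
      using form by (simp add: is_error_matrix_def Q_def N_def)
  next
    fix R assume R: "is_error_matrix M d \<gamma> R"
    have Rc: "R \<in> carrier_mat (2*N) (2*N)" "transpose_mat R = R"
      using R by (auto simp: is_error_matrix_def N_def)
    have Qc: "Q \<in> carrier_mat (2*N) (2*N)" "transpose_mat Q = Q"
      by (simp add: Q_def) (rule eq_matI, simp_all add: Q_def w_sym)
    have eq: "x \<bullet> (R *\<^sub>v x) = x \<bullet> (Q *\<^sub>v x)" if x: "x \<in> carrier_vec (2*N)" for x
    proof -
      define y z where "y = Matrix.vec N (\<lambda>i. x $ i)" and "z = Matrix.vec N (\<lambda>i. x $ (N + i))"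
      have sp: "x = y @\<^sub>v z"
        using x by (intro eq_vecI) (auto simp: y_def z_def)
      have yz: "y \<in> carrier_vec N" "z \<in> carrier_vec N"
        by (auto simp: y_def z_def)
      have "spectral_error M d \<gamma> y z = (y @\<^sub>v z) \<bullet> (R *\<^sub>v (y @\<^sub>v z))"
        using R yz unfolding is_error_matrix_def N_def by blast
      then show ?thesis
        using form[OF yz] by (simp add: sp)
    qed
    have unit: "unit_vec (2*N) i \<bullet> (A *\<^sub>v unit_vec (2*N) j) = A $$ (i, j)"
      if "A \<in> carrier_mat (2*N) (2*N)" "i < 2*N" "j < 2*N" for A :: "real mat" and i j
      using that by simp
    have pol: "(unit_vec (2*N) i + unit_vec (2*N) j) \<bullet> (A *\<^sub>v (unit_vec (2*N) i + unit_vec (2*N) j))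
        = A $$ (i, i) + A $$ (j, j) + 2 * A $$ (i, j)"
      if A: "A \<in> carrier_mat (2*N) (2*N)" "transpose_mat A = A" and ij: "i < 2*N" "j < 2*N"
      for A :: "real mat" and i j
    proof -
      have "A $$ (j, i) = A $$ (i, j)"
        using index_transpose_mat(1)[of i A j] A(1) ij unfolding A(2) by auto
      moreover have c: "A *\<^sub>v unit_vec (2*N) k \<in> carrier_vec (2*N)" for k
        using A(1) by auto
      ultimately show ?thesis
        using unit[OF A(1) ij(1) ij(1)] unit[OF A(1) ij] unit[OF A(1) ij(2) ij(1)]
          unit[OF A(1) ij(2) ij(2)]
        by (simp only: mult_add_distrib_mat_vec[OF A(1) unit_vec_carrier unit_vec_carrier]
            add_scalar_prod_distrib[OF unit_vec_carrier unit_vec_carrier add_carrier_vec[OF c c]]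
            scalar_prod_add_distrib[OF unit_vec_carrier c c])
    qed
    show "R = Q"
    proof (rule eq_matI)
      fix i j assume "i < dim_row Q" "j < dim_col Q"
      then have ij: "i < 2*N" "j < 2*N" by (auto simp: Q_def)
      have "R $$ (k, k) = Q $$ (k, k)" if "k < 2*N" for k
        using eq[OF unit_vec_carrier, of k] unit[OF Rc(1) that that] unit[OF Qc(1) that that]
        by simp
      then show "R $$ (i, j) = Q $$ (i, j)"
        using eq[OF add_carrier_vec[OF unit_vec_carrier unit_vec_carrier], of i j]
          pol[OF Rc ij] pol[OF Qc ij] ij by simp
    qed (use Rc in \<open>auto simp: Q_def\<close>)
  qed
qed

end

theory Submission
  imports Defs
begin

text \<open>
  Reversal \<open>(a, b) \<mapsto> (J a, J b)\<close> is the substitution \<open>m \<mapsto> -m\<close> of the grid index. It preserves the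
  problem. In the objective the cosine residual is unchanged and the sine residual changes sign,
  so their squares stay the same. Since \<open>d\<close> is even, every homogeneous constraint is multiplied by
  \<open>1\<close> or \<open>-1\<close>, and the value of \<open>b\<close> at the central index does not move. Hence the reversal of an
  optimal pair is optimal, and it suffices that the optimal pair is unique.

  Uniqueness combines convexity with the KKT matrix. The objective is a quadratic form \<open>x \<bullet> Q x\<close>
  which is nonnegative because the weight is. If \<open>x\<close> and \<open>y\<close> are both optimal, then the parallelogram
  law, applied to the feasible midpoint, forces the form to vanish at \<open>z = x - y\<close>; for a positive
  semidefinite matrix this gives \<open>Q z = 0\<close> (lemma \<open>quadratic_minimizers_diff\<close>). As \<open>x\<close> and \<open>y\<close> satisfy
  the same linear equations, also \<open>K z = 0\<close>. So \<open>(z, 0)\<close> lies in the kernel of the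
  invertible KKT matrix (lemma \<open>saddle_point_kernel\<close>), and \<open>z = 0\<close>.
\<close>

section \<open>Minimizers of a positive semidefinite form on an affine subspace\<close>

lemma quadratic_form_line:
  fixes Q :: "real mat"
  assumes Q: "Q \<in> carrier_mat n n" and sym: "transpose_mat Q = Q"
    and x: "x \<in> carrier_vec n" and y: "y \<in> carrier_vec n"
  shows "(x + t \<cdot>\<^sub>v y) \<bullet> (Q *\<^sub>v (x + t \<cdot>\<^sub>v y)) =
    x \<bullet> (Q *\<^sub>v x) + 2 * t * (y \<bullet> (Q *\<^sub>v x)) + t\<^sup>2 * (y \<bullet> (Q *\<^sub>v y))"
proof -
  have c: "Q *\<^sub>v x \<in> carrier_vec n" "Q *\<^sub>v y \<in> carrier_vec n" "t \<cdot>\<^sub>v y \<in> carrier_vec n"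
    "t \<cdot>\<^sub>v (Q *\<^sub>v y) \<in> carrier_vec n"
    using Q x y by auto
  have "x \<bullet> (Q *\<^sub>v y) = (Q *\<^sub>v x) \<bullet> y"
    using transpose_vec_mult_scalar[OF Q y x] unfolding sym by simp
  then have s: "x \<bullet> (Q *\<^sub>v y) = y \<bullet> (Q *\<^sub>v x)"
    using comm_scalar_prod[OF c(1) y] by simp
  have "Q *\<^sub>v (x + t \<cdot>\<^sub>v y) = Q *\<^sub>v x + t \<cdot>\<^sub>v (Q *\<^sub>v y)"
    by (simp add: mult_add_distrib_mat_vec[OF Q x c(3)] mult_mat_vec[OF Q y])
  then have "(x + t \<cdot>\<^sub>v y) \<bullet> (Q *\<^sub>v (x + t \<cdot>\<^sub>v y)) =
      x \<bullet> (Q *\<^sub>v x) + t * (x \<bullet> (Q *\<^sub>v y)) + (t * (y \<bullet> (Q *\<^sub>v x)) + t * (t * (y \<bullet> (Q *\<^sub>v y))))"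
    using c x y
    by (simp only: add_scalar_prod_distrib[OF x c(3) add_carrier_vec[OF c(1) c(4)]]
        scalar_prod_add_distrib[OF x c(1) c(4)] scalar_prod_add_distrib[OF c(3) c(1) c(4)]
        scalar_prod_smult_distrib[OF x c(2)] smult_scalar_prod_distrib[OF y c(1)]
        smult_scalar_prod_distrib[OF y c(4)] scalar_prod_smult_distrib[OF y c(2)])
  then show ?thesis
    by (simp add: s power2_eq_square algebra_simps)
qed

text \<open>
  A short step from \<open>z\<close>, where the form is zero, against \<open>w = Q z\<close> decreases the form at a rate of
  twice the squared norm of \<open>w\<close>, which would make it negative unless \<open>w\<close> vanishes.
\<close>

lemma psd_form_zero_imp_kernel:
  fixes Q :: "real mat"
  assumes Q: "Q \<in> carrier_mat n n" and sym: "transpose_mat Q = Q"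
    and psd: "\<And>x. x \<in> carrier_vec n \<Longrightarrow> 0 \<le> x \<bullet> (Q *\<^sub>v x)"
    and z: "z \<in> carrier_vec n" and zero: "z \<bullet> (Q *\<^sub>v z) = 0"
  shows "Q *\<^sub>v z = 0\<^sub>v n"
proof -
  define w where "w = Q *\<^sub>v z"
  define c where "c = w \<bullet> w"
  define F where "F = w \<bullet> (Q *\<^sub>v w)"
  have w: "w \<in> carrier_vec n"
    using Q z by (simp add: w_def)
  have F: "F \<ge> 0"
    using psd[OF w] by (simp add: F_def)
  have line: "0 \<le> 2 * t * c + t\<^sup>2 * F" for t
    using psd[of "z + t \<cdot>\<^sub>v w"] quadratic_form_line[OF Q sym z w, of t] z w zero
    by (simp add: c_def F_def flip: w_def)
  \<comment> \<open>At this \<open>t\<close> the right-hand side is \<open>c\<^sup>2\<close> times a negative number; adding \<open>1\<close> to \<open>F\<close> covers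
     the case \<open>F = 0\<close>.\<close>
  have "2 * (- c / (1 + F)) * c + (- c / (1 + F))\<^sup>2 * F = - (c\<^sup>2 * (2 + F)) / (1 + F)\<^sup>2"
    using F by (simp add: divide_simps power2_eq_square) (simp add: algebra_simps)
  with line[of "- c / (1 + F)"] have "0 \<le> - (c\<^sup>2 * (2 + F)) / (1 + F)\<^sup>2"
    by simp
  then have "c\<^sup>2 * (2 + F) \<le> 0"
    using F by (simp add: divide_simps split: if_splits)
  then have "c = 0"
    using F by (simp add: mult_le_0_iff)
  then have "w \<bullet>c w = 0"
    by (simp add: c_def)
  then show ?thesis
    using conjugate_square_eq_0_vec[OF w] by (simp add: w_def)
qed

text \<open>
  On the line through two minimizers the form is a parabola with equal values at both ends; were it
  not constant, its value at the midpoint would be smaller.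
\<close>

lemma quadratic_minimizers_diff:
  fixes Q K :: "real mat"
  assumes Q: "Q \<in> carrier_mat n n" and sym: "transpose_mat Q = Q"
    and psd: "\<And>x. x \<in> carrier_vec n \<Longrightarrow> 0 \<le> x \<bullet> (Q *\<^sub>v x)"
    and K: "K \<in> carrier_mat k n"
    and x: "x \<in> carrier_vec n" and y: "y \<in> carrier_vec n"
    and Kx: "K *\<^sub>v x = u" and Ky: "K *\<^sub>v y = u"
    and min: "\<And>w. w \<in> carrier_vec n \<Longrightarrow> K *\<^sub>v w = u \<Longrightarrow> y \<bullet> (Q *\<^sub>v y) \<le> w \<bullet> (Q *\<^sub>v w)"
    and eq: "x \<bullet> (Q *\<^sub>v x) = y \<bullet> (Q *\<^sub>v y)"
  shows "Q *\<^sub>v (x - y) = 0\<^sub>v n" and "K *\<^sub>v (x - y) = 0\<^sub>v k"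
proof -
  define z where "z = x - y"
  have z: "z \<in> carrier_vec n"
    using x y by (simp add: z_def)
  have u: "u \<in> carrier_vec k"
    using K x Kx by auto
  have Kz: "K *\<^sub>v z = 0\<^sub>v k"
    using mult_minus_distrib_mat_vec[OF K x y] u by (simp add: z_def Kx Ky)
  then show "K *\<^sub>v (x - y) = 0\<^sub>v k"
    by (simp add: z_def)
  have "K *\<^sub>v (y + (1/2) \<cdot>\<^sub>v z) = u"
    using u z
    by (auto simp: mult_add_distrib_mat_vec[OF K y] mult_mat_vec[OF K z] Kz Ky intro!: eq_vecI)
  then have mid: "y \<bullet> (Q *\<^sub>v y) \<le> (y + (1/2) \<cdot>\<^sub>v z) \<bullet> (Q *\<^sub>v (y + (1/2) \<cdot>\<^sub>v z))"
    using y z by (intro min) auto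
  have "y + 1 \<cdot>\<^sub>v z = x"
    using x y by (intro eq_vecI) (auto simp: z_def)
  then have "z \<bullet> (Q *\<^sub>v z) \<le> 0"
    using mid quadratic_form_line[OF Q sym y z, of 1] quadratic_form_line[OF Q sym y z, of "1/2"] eq
    by (simp add: power2_eq_square)
  then have "z \<bullet> (Q *\<^sub>v z) = 0"
    using psd[OF z] by simp
  then show "Q *\<^sub>v (x - y) = 0\<^sub>v n"
    using psd_form_zero_imp_kernel[OF Q sym psd z] by (simp add: z_def)
qed

lemma invertible_mat_kernel:
  fixes A :: "'a :: comm_ring_1 mat"
  assumes "invertible_mat A" and A: "A \<in> carrier_mat n n"
    and v: "v \<in> carrier_vec n" and Av: "A *\<^sub>v v = 0\<^sub>v n"
  shows "v = 0\<^sub>v n"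
proof -
  obtain B where AB: "inverts_mat A B" and BA: "inverts_mat B A"
    using assms(1) by (auto simp: invertible_mat_def)
  have "dim_col B = n"
    using arg_cong[OF AB[unfolded inverts_mat_def], of dim_col] A by simp
  moreover have "dim_row B = n"
    using arg_cong[OF BA[unfolded inverts_mat_def], of dim_col] A by simp
  ultimately have B: "B \<in> carrier_mat n n"
    by auto
  have "v = (B * A) *\<^sub>v v"
    using BA B v by (simp add: inverts_mat_def)
  also have "\<dots> = B *\<^sub>v (A *\<^sub>v v)"
    by (rule assoc_mult_mat_vec[OF B A v])
  also have "\<dots> = 0\<^sub>v n"
    using B by (intro eq_vecI) (auto simp: Av)
  finally show ?thesis .
qed

lemma saddle_point_kernel:
  fixes Q K :: "real mat"
  assumes inv: "invertible_mat (four_block_mat Q (transpose_mat K) K (0\<^sub>m k k))"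
    and Q: "Q \<in> carrier_mat n n" and K: "K \<in> carrier_mat k n" and z: "z \<in> carrier_vec n"
    and Qz: "Q *\<^sub>v z = 0\<^sub>v n" and Kz: "K *\<^sub>v z = 0\<^sub>v k"
  shows "z = 0\<^sub>v n"
proof -
  let ?S = "four_block_mat Q (transpose_mat K) K (0\<^sub>m k k)"
  have "?S *\<^sub>v (z @\<^sub>v 0\<^sub>v k) =
      (Q *\<^sub>v z + transpose_mat K *\<^sub>v 0\<^sub>v k) @\<^sub>v (K *\<^sub>v z + 0\<^sub>m k k *\<^sub>v 0\<^sub>v k)"
    using Q K z by (intro four_block_mat_mult_vec) auto
  also have "\<dots> = 0\<^sub>v (n + k)"
    using K by (intro eq_vecI) (auto simp: Qz Kz scalar_prod_def)
  finally have Sz: "?S *\<^sub>v (z @\<^sub>v 0\<^sub>v k) = 0\<^sub>v (n + k)" .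
  have S: "?S \<in> carrier_mat (n + k) (n + k)"
    by (rule four_block_carrier_mat[OF Q zero_carrier_mat])
  have "z @\<^sub>v 0\<^sub>v k = 0\<^sub>v (n + k)"
    by (rule invertible_mat_kernel[OF inv S append_carrier_vec[OF z zero_carrier_vec] Sz])
  also have "0\<^sub>v (n + k) = 0\<^sub>v n @\<^sub>v (0\<^sub>v k :: real vec)"
    by (intro eq_vecI) auto
  finally show ?thesis
    using append_vec_eq[OF z zero_carrier_vec] by blast
qed

section \<open>Invariance of the problem under reversal\<close>

lemma exchange_matrix_carrier [simp]: "exchange_matrix n \<in> carrier_mat n n"
  by (simp add: exchange_matrix_def)

lemma exchange_matrix_mult_vec_carrier [simp]: "exchange_matrix n *\<^sub>v a \<in> carrier_vec n"
  by (metis exchange_matrix_carrier carrier_matD(1) dim_mult_mat_vec carrier_vecI)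

lemma index_exchange_matrix_mult_vec:
  assumes a: "a \<in> carrier_vec n" and i: "i < n"
  shows "(exchange_matrix n *\<^sub>v a) $ i = a $ (n - Suc i)"
proof -
  have "(exchange_matrix n *\<^sub>v a) $ i = (\<Sum>j = 0..<n. (if i + j + 1 = n then 1 else 0) * a $ j)"
    using a i by (simp add: exchange_matrix_def scalar_prod_def)
  also have "\<dots> = (\<Sum>j = 0..<n. if j = n - Suc i then a $ j else 0)"
    using i by (intro sum.cong refl) auto
  finally show ?thesis
    using i by simp
qed

text \<open>
  The residuals and the homogeneous constraints are built from moments \<open>\<Sum> f(m) a\<^sub>m\<close> of the
  coefficients, so the effect of \<open>J\<close> on them is decided by the parity of \<open>f\<close>.
\<close>

lemma sum_grid_exchange:
  assumes a: "a \<in> carrier_vec (2 * M + 1)"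
  shows "(\<Sum>i<2 * M + 1. f (grid M i) * (exchange_matrix (2 * M + 1) *\<^sub>v a) $ i) =
    (\<Sum>i<2 * M + 1. f (- grid M i) * a $ i)"
proof -
  let ?N = "2 * M + 1"
  have "(\<Sum>i<?N. f (grid M i) * (exchange_matrix ?N *\<^sub>v a) $ i) =
      (\<Sum>i<?N. f (- grid M (?N - Suc i)) * a $ (?N - Suc i))"
  proof (intro sum.cong refl)
    fix i assume "i \<in> {..<?N}"
    moreover from this have "grid M i = - grid M (?N - Suc i)"
      by (simp add: grid_def of_nat_diff)
    ultimately show "f (grid M i) * (exchange_matrix ?N *\<^sub>v a) $ i =
        f (- grid M (?N - Suc i)) * a $ (?N - Suc i)"
      using index_exchange_matrix_mult_vec[OF a, of i] by (simp del: minus_minus)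
  qed
  also have "\<dots> = (\<Sum>i<?N. f (- grid M i) * a $ i)"
    by (rule sum.nat_diff_reindex)
  finally show ?thesis .
qed

lemma
  assumes a: "a \<in> carrier_vec (2 * M + 1)"
  shows cos_vec_exchange: "cos_vec M \<eta> \<bullet> (exchange_matrix (2 * M + 1) *\<^sub>v a) = cos_vec M \<eta> \<bullet> a"
    and sin_vec_exchange: "sin_vec M \<eta> \<bullet> (exchange_matrix (2 * M + 1) *\<^sub>v a) = - (sin_vec M \<eta> \<bullet> a)"
proof -
  have c: "cos_vec M \<eta> \<bullet> v = (\<Sum>i<2 * M + 1. cos (grid M i * \<eta>) * v $ i)"
    and s: "sin_vec M \<eta> \<bullet> v = (\<Sum>i<2 * M + 1. sin (grid M i * \<eta>) * v $ i)"
    if "v \<in> carrier_vec (2 * M + 1)" for v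
    using that by (auto simp: cos_vec_def sin_vec_def scalar_prod_def atLeast0LessThan)
  show "cos_vec M \<eta> \<bullet> (exchange_matrix (2 * M + 1) *\<^sub>v a) = cos_vec M \<eta> \<bullet> a"
    unfolding c[OF exchange_matrix_mult_vec_carrier] c[OF a]
      sum_grid_exchange[OF a, where f = "\<lambda>m. cos (m * \<eta>)"] by simp
  show "sin_vec M \<eta> \<bullet> (exchange_matrix (2 * M + 1) *\<^sub>v a) = - (sin_vec M \<eta> \<bullet> a)"
    unfolding s[OF exchange_matrix_mult_vec_carrier] s[OF a]
      sum_grid_exchange[OF a, where f = "\<lambda>m. sin (m * \<eta>)"] by (simp add: sum_negf)
qed

lemma spectral_error_exchange:
  assumes "a \<in> carrier_vec (2 * M + 1)" and "b \<in> carrier_vec (2 * M + 1)"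
  shows "spectral_error M d \<gamma> (exchange_matrix (2 * M + 1) *\<^sub>v a) (exchange_matrix (2 * M + 1) *\<^sub>v b) =
    spectral_error M d \<gamma> a b"
proof -
  have "(- x - s * - y)\<^sup>2 = (x - s * y)\<^sup>2" for x y s :: real
    by (simp add: power2_eq_square algebra_simps)
  then show ?thesis
    using assms by (simp only: spectral_error_def cos_vec_exchange sin_vec_exchange)
qed

lemma spectral_error_nonneg:
  assumes "\<And>\<eta>. \<eta> \<in> {0..pi} \<Longrightarrow> \<gamma> \<eta> \<ge> 0"
  shows "0 \<le> spectral_error M d \<gamma> a b"
  unfolding spectral_error_def set_lebesgue_integral_def
  using assms by (intro Bochner_Integration.integral_nonneg) (auto simp: indicator_def)

text \<open>
  The order condition of index \<open>r\<close> pairs \<open>m\<^bsup>d + r\<^esup>\<close> with \<open>m\<^bsup>r\<^esup>\<close>. For even \<open>d\<close> these have the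
  same parity, so reversal multiplies the whole condition by \<open>(-1)\<^bsup>r\<^esup>\<close>; for odd \<open>d\<close> it would
  change the relative sign of the two terms.
\<close>

lemma feasible_exchange:
  assumes "even d" and feas: "feasible M d p a b"
  shows "feasible M d p (exchange_matrix (2 * M + 1) *\<^sub>v a) (exchange_matrix (2 * M + 1) *\<^sub>v b)"
proof -
  let ?N = "2 * M + 1"
  let ?J = "\<lambda>v. exchange_matrix ?N *\<^sub>v v"
  have a: "a \<in> carrier_vec ?N" and b: "b \<in> carrier_vec ?N"
    using feas by (auto simp: feasible_def)
  have mom: "(\<Sum>i<?N. grid M i ^ k / c * ?J v $ i) = (-1) ^ k * (\<Sum>i<?N. grid M i ^ k / c * v $ i)"
    if "v \<in> carrier_vec ?N" for k v and c :: real
    unfolding sum_grid_exchange[OF that, where f = "\<lambda>m. m ^ k / c"] sum_distrib_left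
    by (intro sum.cong refl) (simp add: power_minus[of "grid M _"])
  have "(\<Sum>i<?N. ?J a $ i * grid M i ^ k) = 0" if "k < d" for k
  proof -
    have "(\<Sum>i<?N. a $ i * grid M i ^ k) = 0"
      using feas that by (simp add: feasible_def)
    then show ?thesis
      using mom[OF a, of k 1] by (simp add: mult.commute)
  qed
  moreover have "(\<Sum>i<?N. grid M i ^ (d + r) / fact (d + r) * ?J a $ i -
      grid M i ^ r / fact r * ?J b $ i) = 0" if "r \<le> p" for r
  proof -
    have "(\<Sum>i<?N. grid M i ^ (d + r) / fact (d + r) * a $ i) -
        (\<Sum>i<?N. grid M i ^ r / fact r * b $ i) = 0"
      using feas that unfolding feasible_def sum_subtractf by blast
    moreover have "(-1 :: real) ^ (d + r) = (-1) ^ r"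
      using \<open>even d\<close> by (simp add: power_add)
    ultimately show ?thesis
      unfolding sum_subtractf mom[OF a] mom[OF b] by simp
  qed
  moreover have "?J b $ M = 1"
    using feas index_exchange_matrix_mult_vec[OF b, of M] by (simp add: feasible_def)
  ultimately show ?thesis
    by (simp add: feasible_def)
qed

section \<open>Symmetry of the optimal coefficients\<close>

theorem lemma2:
  fixes M d p :: nat and \<gamma> :: "real \<Rightarrow> real" and a b :: "real vec"
  assumes "even d" and "d \<ge> 2" and "M \<ge> 1"
    and "set_integrable lebesgue {0..pi} \<gamma>"
    and "\<And>\<eta>. \<eta> \<in> {0..pi} \<Longrightarrow> \<gamma> \<eta> \<ge> 0"
    and "invertible_mat (KKT_matrix M d p \<gamma>)"
    and "optimal M d p \<gamma> a b"
  shows "exchange_matrix (2 * M + 1) *\<^sub>v a = a \<and> exchange_matrix (2 * M + 1) *\<^sub>v b = b"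
proof -
  define N where "N = 2 * M + 1"
  define Q where "Q = error_matrix M d \<gamma>"
  define K where "K = constraint_matrix M d p"
  define u :: "real vec" where "u = unit_vec (d + p + 2) (d + p + 1)"
  define a' b' where "a' = exchange_matrix N *\<^sub>v a" and "b' = exchange_matrix N *\<^sub>v b"
  define x y where "x = a' @\<^sub>v b'" and "y = a @\<^sub>v b"
  have feas: "feasible M d p a b"
    and least: "\<And>v w. feasible M d p v w \<Longrightarrow> spectral_error M d \<gamma> a b \<le> spectral_error M d \<gamma> v w"
    using assms(7) by (auto simp: optimal_def is_arg_min_linorder)
  have a: "a \<in> carrier_vec N" and b: "b \<in> carrier_vec N"
    using feas by (auto simp: feasible_def N_def)
  have a': "a' \<in> carrier_vec N" and b': "b' \<in> carrier_vec N"
    by (simp_all add: a'_def b'_def)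
  have x: "x \<in> carrier_vec (N + N)" and y: "y \<in> carrier_vec (N + N)"
    using a b a' b' by (simp_all add: x_def y_def)
  have "is_error_matrix M d \<gamma> Q"
    unfolding Q_def error_matrix_def by (rule theI'[OF ex1_error_matrix[OF assms(4)]])
  then have Q: "Q \<in> carrier_mat (N + N) (N + N)" and sym: "transpose_mat Q = Q"
    and err: "\<And>v w. v \<in> carrier_vec N \<Longrightarrow> w \<in> carrier_vec N \<Longrightarrow>
      (v @\<^sub>v w) \<bullet> (Q *\<^sub>v (v @\<^sub>v w)) = spectral_error M d \<gamma> v w"
    by (simp_all add: is_error_matrix_def N_def mult_2)
  have K: "K \<in> carrier_mat (d + p + 2) (N + N)"
    by (simp add: K_def constraint_matrix_def N_def)
  have feas_iff: "\<And>v w. v \<in> carrier_vec N \<Longrightarrow> w \<in> carrier_vec N \<Longrightarrow>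
      feasible M d p v w \<longleftrightarrow> K *\<^sub>v (v @\<^sub>v w) = u"
    unfolding N_def K_def u_def by (rule feasible_iff_constraint_matrix)
  have halves: "\<exists>v w. t = v @\<^sub>v w \<and> v \<in> carrier_vec N \<and> w \<in> carrier_vec N"
    if "t \<in> carrier_vec (N + N)" for t :: "real vec"
    using vec_first_last_append[OF that] vec_first_carrier vec_last_carrier by metis
  have psd: "0 \<le> t \<bullet> (Q *\<^sub>v t)" if "t \<in> carrier_vec (N + N)" for t
    using halves[OF that] err spectral_error_nonneg[OF assms(5)] by fastforce
  have Kx: "K *\<^sub>v x = u"
    using feasible_exchange[OF assms(1) feas] feas_iff[OF a' b']
    by (simp add: x_def a'_def b'_def N_def)
  have Ky: "K *\<^sub>v y = u"
    using feas feas_iff[OF a b] by (simp add: y_def)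
  have min: "y \<bullet> (Q *\<^sub>v y) \<le> t \<bullet> (Q *\<^sub>v t)"
    if tc: "t \<in> carrier_vec (N + N)" and Kt: "K *\<^sub>v t = u" for t
  proof -
    obtain v w where t: "t = v @\<^sub>v w" and v: "v \<in> carrier_vec N" and w: "w \<in> carrier_vec N"
      using halves[OF tc] by blast
    then have "feasible M d p v w"
      using feas_iff[OF v w] Kt by simp
    then show ?thesis
      unfolding y_def t err[OF a b] err[OF v w] by (rule least)
  qed
  have eq: "x \<bullet> (Q *\<^sub>v x) = y \<bullet> (Q *\<^sub>v y)"
    using spectral_error_exchange[of a M b d \<gamma>] a b
    unfolding x_def y_def err[OF a' b'] err[OF a b] by (simp add: a'_def b'_def N_def)
  note kernel = quadratic_minimizers_diff[OF Q sym psd K x y Kx Ky min eq]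
  have "x - y = 0\<^sub>v (N + N)"
    using assms(6) x y
    by (intro saddle_point_kernel[OF _ Q K _ kernel])
      (simp_all add: KKT_matrix_def Q_def K_def)
  then have "x = y"
    using x y by (auto simp: vec_eq_iff)
  then show ?thesis
    using append_vec_eq[OF a' a] by (simp add: x_def y_def a'_def b'_def N_def)
qed

end
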